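(* Let $h\ge 1$ be an integer and let $P\subset\mathbb R^2$ be a minimal lattice polygon with $\operatorname{ls}_\square(P)=h$. Then $P$ is lattice-equivalent to one of the following: (a) the segment $[(0,0),(h,0)]$; (b) a triangle $\operatorname{conv}\{(0,0),(a,h),(h,b)\}$ with integers $a,b\in[1,h-1]$ and $a+b\ge h$; (c) a quadrilateral $\operatorname{conv}\{(a,0),(0,b),(h,h-c),(h-d,h)\}$ with integers $a,b,c,d\in[1,h-1]$ and $\min\{a,b\}+\min\{c,d\}>h$.
   Context: A lattice polygon is a convex polygon (possibly degenerate, e.g. a segment) all of whose vertices lie in $\mathbb Z^2$. An affine unimodular transformation is $x\mapsto Ax+v$ with $A\in\mathbb Z^{2\times2}$, $\det A=\pm1$, $v\in\mathbb Z^2$; two sets are lattice-equivalent if one is the image of the other under such a map. With $\square=[0,1]^2$, $\operatorname{ls}_\square(P)$ is the smallest $l\ge0$ such that $\varphi(P)\subseteq l\square$ for some affine unimodular $\varphi$. A lattice polygon $P$ with $\operatorname{ls}_\square(P)=h$ is minimal if no lattice polygon properly contained in $P$ has $\operatorname{ls}_\square$ equal to $h$. *)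

theory Defs
  imports "HOL-Analysis.Analysis"
begin

type_synonym pt = "real \<times> real"

definition int_pt :: "pt \<Rightarrow> bool" where
  "int_pt p \<longleftrightarrow> fst p \<in> \<int> \<and> snd p \<in> \<int>"

definition lattice_polygon :: "pt set \<Rightarrow> bool" where
  "lattice_polygon P \<longleftrightarrow>
     (\<exists>S. finite S \<and> S \<noteq> {} \<and> (\<forall>p\<in>S. int_pt p) \<and> P = convex hull S)"

definition aff_unimodular :: "(pt \<Rightarrow> pt) \<Rightarrow> bool" where
  "aff_unimodular f \<longleftrightarrow>
     (\<exists>a b c d v1 v2 :: int. (a * d - b * c = 1 \<or> a * d - b * c = -1) \<and>
        f = (\<lambda>(x, y). (of_int a * x + of_int b * y + of_int v1,
                        of_int c * x + of_int d * y + of_int v2)))"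

definition lattice_equiv :: "pt set \<Rightarrow> pt set \<Rightarrow> bool" where
  "lattice_equiv P Q \<longleftrightarrow> (\<exists>f. aff_unimodular f \<and> f ` P = Q)"

definition unit_square :: "pt set" where
  "unit_square = {0..1} \<times> {0..1}"

definition ls_sq :: "pt set \<Rightarrow> real" where
  "ls_sq P = Inf {l. l \<ge> 0 \<and> (\<exists>f. aff_unimodular f \<and> f ` P \<subseteq> (\<lambda>p. l *\<^sub>R p) ` unit_square)}"

definition minimal_lp :: "pt set \<Rightarrow> bool" where
  "minimal_lp P \<longleftrightarrow> lattice_polygon P \<and>
     (\<forall>Q. lattice_polygon Q \<and> Q \<subset> P \<longrightarrow> ls_sq Q \<noteq> ls_sq P)"

end

theory Submission
  imports Defs
begin

text \<open>For an integer functional \<open>u\<close> let \<open>w(u)\<close> be the width of the polygon in direction \<open>u\<close>; then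
  \<open>ls_sq\<close> is the least \<open>max (w u) (w v)\<close> over lattice bases \<open>u, v\<close>. If \<open>w(x) = w(y) = h\<close>, the
  reverse triangle inequality gives \<open>w(i x + j y) \<ge> \<bar>\<bar>i\<bar> - \<bar>j\<bar>\<bar> h\<close>, and no two functionals with
  \<open>\<bar>i\<bar> = \<bar>j\<bar>\<close> form a basis. Hence every lattice polygon touching all four sides of
  \<open>[0, h]\<^sup>2\<close> has size \<open>h\<close>, and a minimal one is spanned by any four lattice points on the
  four sides. If a minimal polygon in the square does not touch all sides, say \<open>w(x) < h = w(y)\<close>,
  then \<open>w(y - x) \<ge> h\<close>, and it contains a lattice polygon with \<open>w(y) = w(y - x) = h\<close> (or a segment
  of lattice length \<open>h\<close>), which is again of the first kind. What remains is to discard the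
  quadrilaterals and triangles containing a smaller polygon with \<open>w(y) = h\<close> or \<open>w(x) = h\<close> and
  \<open>w(x + y), w(x - y) \<ge> h\<close>.\<close>

section \<open>Lattice points and the group of affine unimodular maps\<close>

definition emb :: "int \<times> int \<Rightarrow> pt" where
  "emb p = (of_int (fst p), of_int (snd p))"

lemma int_pt_iff_emb: "int_pt p \<longleftrightarrow> (\<exists>q. p = emb q)"
proof
  assume "int_pt p"
  then obtain x y where "fst p = of_int x" "snd p = of_int y"
    unfolding int_pt_def by (metis Ints_cases)
  then have "p = emb (x, y)" by (simp add: emb_def prod_eq_iff)
  then show "\<exists>q. p = emb q" ..
qed (auto simp: int_pt_def emb_def)

lemma lattice_polygon_iff_emb:
  "lattice_polygon P \<longleftrightarrow> (\<exists>S. finite S \<and> S \<noteq> {} \<and> P = convex hull (emb ` S))"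
proof
  assume "lattice_polygon P"
  then obtain S where S: "finite S" "S \<noteq> {}" "\<forall>p\<in>S. int_pt p" "P = convex hull S"
    unfolding lattice_polygon_def by blast
  have "S \<subseteq> range emb" using S(3) by (auto simp: int_pt_iff_emb)
  then obtain T where "finite T" "S = emb ` T" using S(1) by (meson finite_subset_image)
  with S show "\<exists>S. finite S \<and> S \<noteq> {} \<and> P = convex hull (emb ` S)" by blast
next
  assume "\<exists>S. finite S \<and> S \<noteq> {} \<and> P = convex hull (emb ` S)"
  then obtain S where "finite (emb ` S)" "emb ` S \<noteq> {}" "P = convex hull (emb ` S)" by blast
  moreover have "\<forall>p\<in>emb ` S. int_pt p" by (simp add: int_pt_def emb_def)
  ultimately show "lattice_polygon P" unfolding lattice_polygon_def by metis
qed

lemma aff_unimodularI: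
  fixes a b c d v1 v2 :: int
  assumes "a * d - b * c = 1 \<or> a * d - b * c = -1"
  shows "aff_unimodular (\<lambda>(x, y). (of_int a * x + of_int b * y + of_int v1,
                                   of_int c * x + of_int d * y + of_int v2))"
  unfolding aff_unimodular_def
  by (rule exI[of _ a], rule exI[of _ b], rule exI[of _ c], rule exI[of _ d],
      rule exI[of _ v1], rule exI[of _ v2]) (simp add: assms)

lemma aff_unimodular_id: "aff_unimodular id"
  using aff_unimodularI[of 1 1 0 0 0 0] by (simp add: id_def case_prod_beta')

lemma aff_unimodular_comp:
  assumes "aff_unimodular f" "aff_unimodular g"
  shows "aff_unimodular (g \<circ> f)"
proof -
  obtain a b c d v w :: int where f: "a * d - b * c = 1 \<or> a * d - b * c = -1"
    "f = (\<lambda>(x, y). (of_int a * x + of_int b * y + of_int v, of_int c * x + of_int d * y + of_int w))"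
    using assms(1) unfolding aff_unimodular_def by blast
  obtain a' b' c' d' v' w' :: int where g: "a' * d' - b' * c' = 1 \<or> a' * d' - b' * c' = -1"
    "g = (\<lambda>(x, y). (of_int a' * x + of_int b' * y + of_int v', of_int c' * x + of_int d' * y + of_int w'))"
    using assms(2) unfolding aff_unimodular_def by blast
  have "(a' * a + b' * c) * (c' * b + d' * d) - (a' * b + b' * d) * (c' * a + d' * c)
      = (a * d - b * c) * (a' * d' - b' * c')"
    by algebra
  then have "(a' * a + b' * c) * (c' * b + d' * d) - (a' * b + b' * d) * (c' * a + d' * c) = 1 \<or>
    (a' * a + b' * c) * (c' * b + d' * d) - (a' * b + b' * d) * (c' * a + d' * c) = -1"
    using f(1) g(1) by auto
  from aff_unimodularI[OF this, of "a' * v + b' * w + v'" "c' * v + d' * w + w'"]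
  show ?thesis
    unfolding f(2) g(2) by (rule back_subst[where P = aff_unimodular]) (auto simp: fun_eq_iff algebra_simps)
qed

lemma aff_unimodular_inverse:
  assumes "aff_unimodular f"
  obtains g where "aff_unimodular g" "\<And>x. g (f x) = x" "\<And>x. f (g x) = x"
proof -
  obtain a b c d v w :: int where f: "a * d - b * c = 1 \<or> a * d - b * c = -1"
    "f = (\<lambda>(x, y). (of_int a * x + of_int b * y + of_int v, of_int c * x + of_int d * y + of_int w))"
    using assms(1) unfolding aff_unimodular_def by blast
  \<comment> \<open>As \<open>e\<close> is its own inverse, \<open>e\<close> times the adjugate
    matrix is an integral inverse.\<close>
  define e where "e = a * d - b * c"
  have ee: "e * e = 1" "e = 1 \<or> e = -1" using f(1) by (auto simp: e_def)
  have "(e * d) * (e * a) - (- e * b) * (- e * c) = e * e * e" unfolding e_def by algebra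
  then have "(e * d) * (e * a) - (- e * b) * (- e * c) = 1 \<or> (e * d) * (e * a) - (- e * b) * (- e * c) = -1"
    using ee by auto
  from aff_unimodularI[OF this, of "e * (b * w - d * v)" "e * (c * v - a * w)"]
  have u: "aff_unimodular (\<lambda>(x, y). (of_int (e * d) * x + of_int (- e * b) * y + of_int (e * (b * w - d * v)),
      of_int (- e * c) * x + of_int (e * a) * y + of_int (e * (c * v - a * w))))" (is "aff_unimodular ?g") .
  have E: "real_of_int e * (of_int a * of_int d - of_int b * of_int c) = 1"
    using ee(1) unfolding e_def by (metis of_int_1 of_int_diff of_int_mult)
  have "?g (f p) = p" for p
  proof (cases p)
    case (Pair x y)
    show ?thesis unfolding Pair f(2) prod.case prod.inject of_int_mult of_int_minus of_int_diff
      using E by (intro conjI; algebra)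
  qed
  moreover have "f (?g p) = p" for p
  proof (cases p)
    case (Pair x y)
    show ?thesis unfolding Pair f(2) prod.case prod.inject of_int_mult of_int_minus of_int_diff
      using E by (intro conjI; algebra)
  qed
  ultimately show ?thesis using that u by blast
qed

lemma aff_unimodular_emb:
  assumes "aff_unimodular f"
  shows "\<exists>q. f (emb p) = emb q"
proof -
  obtain a b c d v w :: int where f:
    "f = (\<lambda>(x, y). (of_int a * x + of_int b * y + of_int v, of_int c * x + of_int d * y + of_int w))"
    using assms(1) unfolding aff_unimodular_def by blast
  show ?thesis
    by (rule exI[of _ "(a * fst p + b * snd p + v, c * fst p + d * snd p + w)"])
      (simp add: f emb_def)
qed

lemma aff_unimodular_convex_hull:
  assumes "aff_unimodular f"
  shows "f ` (convex hull S) = convex hull (f ` S)"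
proof -
  obtain a b c d v w :: int where f:
    "f = (\<lambda>(x, y). (of_int a * x + of_int b * y + of_int v, of_int c * x + of_int d * y + of_int w))"
    using assms(1) unfolding aff_unimodular_def by blast
  define L :: "pt \<Rightarrow> pt" where
    "L = (\<lambda>p. (of_int a * fst p + of_int b * snd p, of_int c * fst p + of_int d * snd p))"
  have L: "linear L"
    by (rule linearI) (auto simp: L_def algebra_simps)
  have fL: "f = (\<lambda>x. (of_int v, of_int w) + x) \<circ> L"
    by (auto simp: f L_def fun_eq_iff algebra_simps)
  show ?thesis
    unfolding fL image_comp[symmetric] convex_hull_translation
    using convex_hull_linear_image[OF L] by simp
qed

lemma aff_unimodular_lattice_polygon:
  assumes "aff_unimodular f" "lattice_polygon P"
  shows "lattice_polygon (f ` P)"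
proof -
  obtain S where S: "finite S" "S \<noteq> {}" "P = convex hull (emb ` S)"
    using assms(2) by (auto simp: lattice_polygon_iff_emb)
  have "finite (f ` emb ` S)" "f ` emb ` S \<noteq> {}" "\<forall>p\<in>f ` emb ` S. int_pt p"
    using S aff_unimodular_emb[OF assms(1)] by (auto simp: int_pt_iff_emb)
  then show ?thesis
    unfolding lattice_polygon_def S(3) aff_unimodular_convex_hull[OF assms(1)] by blast
qed

section \<open>Lattice size as an infimum\<close>

definition ls_set :: "pt set \<Rightarrow> real set" where
  "ls_set P = {l. l \<ge> 0 \<and> (\<exists>f. aff_unimodular f \<and> f ` P \<subseteq> {0..l} \<times> {0..l})}"

lemma scaled_unit_square: "l \<ge> 0 \<Longrightarrow> (\<lambda>p. l *\<^sub>R p) ` unit_square = {0..l} \<times> {0..l}"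
proof -
  assume l: "l \<ge> 0"
  show ?thesis
  proof (cases "l = 0")
    case True
    then show ?thesis by (auto simp: unit_square_def image_iff zero_prod_def intro!: exI[of _ 0])
  next
    case False
    with l have l: "l > 0" by simp
    have "(x, y) \<in> (\<lambda>p. l *\<^sub>R p) ` unit_square" if "x \<in> {0..l}" "y \<in> {0..l}" for x y
      using that l by (intro image_eqI[of _ _ "(x / l, y / l)"]) (auto simp: unit_square_def)
    moreover have "l *\<^sub>R p \<in> {0..l} \<times> {0..l}" if "p \<in> unit_square" for p
      using that l by (cases p) (auto simp: unit_square_def mult_left_le)
    ultimately show ?thesis by auto
  qed
qed

lemma ls_sq_eq_Inf: "ls_sq P = Inf (ls_set P)"
proof -
  have "{l. l \<ge> 0 \<and> (\<exists>f. aff_unimodular f \<and> f ` P \<subseteq> (\<lambda>p. l *\<^sub>R p) ` unit_square)} = ls_set P"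
    unfolding ls_set_def by (rule Collect_cong) (metis scaled_unit_square)
  then show ?thesis by (simp add: ls_sq_def)
qed

lemma bdd_below_ls_set: "bdd_below (ls_set P)"
  by (auto simp: ls_set_def intro: bdd_belowI[of _ 0])

lemma ls_set_mono: "Q \<subseteq> P \<Longrightarrow> ls_set P \<subseteq> ls_set Q"
  by (auto simp: ls_set_def)

lemma ls_set_image:
  assumes "aff_unimodular f"
  shows "ls_set (f ` P) = ls_set P"
proof -
  obtain g where g: "aff_unimodular g" "\<And>x. g (f x) = x"
    using aff_unimodular_inverse[OF assms] by blast
  have sub: "ls_set (k ` Q) \<subseteq> ls_set Q" if "aff_unimodular k" for k Q
    using aff_unimodular_comp[OF that] unfolding ls_set_def image_comp by blast
  have "g ` f ` P = P" using g(2) by (simp add: image_image)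
  then show ?thesis using sub[OF g(1), of "f ` P"] sub[OF assms, of P] by simp
qed

lemma ls_sq_image: "aff_unimodular f \<Longrightarrow> ls_sq (f ` P) = ls_sq P"
  by (simp add: ls_sq_eq_Inf ls_set_image)

lemma ls_set_nonempty:
  assumes "lattice_polygon P"
  shows "ls_set P \<noteq> {}"
proof -
  have "bounded P"
    using assms unfolding lattice_polygon_def
    using bounded_convex_hull finite_imp_bounded by blast
  then obtain B where B: "\<And>p. p \<in> P \<Longrightarrow> norm p \<le> B" by (auto simp: bounded_iff)
  \<comment> \<open>Translations must be integral, so the norm bound is rounded up.\<close>
  define n where "n = max 0 \<lceil>B\<rceil>"
  have nB: "B \<le> of_int n" "n \<ge> 0" unfolding n_def by linarith+
  have u: "aff_unimodular (\<lambda>(x, y). (of_int 1 * x + of_int 0 * y + of_int n,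
                                   of_int 0 * x + of_int 1 * y + of_int n))"
    by (rule aff_unimodularI) simp
  have "(\<lambda>(x, y). (of_int 1 * x + of_int 0 * y + of_int n, of_int 0 * x + of_int 1 * y + of_int n)) ` P
    \<subseteq> {0..2 * of_int n} \<times> {0..2 * real_of_int n}"
  proof safe
    fix x y assume "(x, y) \<in> P"
    then have "norm (x, y) \<le> of_int n" using B nB by force
    then have "\<bar>x\<bar> \<le> of_int n" "\<bar>y\<bar> \<le> of_int n"
      using norm_fst_le[of x y] norm_snd_le[of y x] by auto
    then show "of_int 1 * x + of_int 0 * y + of_int n \<in> {0..2 * real_of_int n}"
      "of_int 0 * x + of_int 1 * y + of_int n \<in> {0..2 * real_of_int n}"
      by auto
  qed
  then have "2 * of_int n \<in> ls_set P"
    unfolding ls_set_def using u nB by auto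
  then show ?thesis by blast
qed

section \<open>Lattice size in terms of widths\<close>

text \<open>The rows \<open>(a, b)\<close>, \<open>(c, d)\<close> are the linear part of a unimodular map, so wideness of \<open>T\<close>
  amounts to \<open>ls_sq (convex hull (emb ` T)) \<ge> h\<close>.\<close>

definition wide :: "int \<Rightarrow> (int \<times> int) set \<Rightarrow> bool" where
  "wide h T \<longleftrightarrow> (\<forall>a b c d. (a * d - b * c = 1 \<or> a * d - b * c = -1) \<longrightarrow>
     (\<exists>z\<in>T. \<exists>w\<in>T. h \<le> \<bar>a * (fst z - fst w) + b * (snd z - snd w)\<bar> \<or>
                     h \<le> \<bar>c * (fst z - fst w) + d * (snd z - snd w)\<bar>))"

lemma wideD:
  assumes "wide h T" "a * d - b * c = 1 \<or> a * d - b * c = -1"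
  shows "\<exists>z\<in>T. \<exists>w\<in>T. h \<le> \<bar>a * (fst z - fst w) + b * (snd z - snd w)\<bar> \<or>
                     h \<le> \<bar>c * (fst z - fst w) + d * (snd z - snd w)\<bar>"
  by (rule assms(1)[unfolded wide_def, rule_format, OF assms(2)])

text \<open>A unimodular map into \<open>[0, l]^2\<close> makes all differences of both rows on
  \<open>T\<close> at most \<open>l\<close>, while wideness makes one of them at least
  \<open>h\<close>.\<close>

lemma wide_imp_ls_ge:
  assumes "wide h T" "emb ` T \<subseteq> P" "lattice_polygon P"
  shows "of_int h \<le> ls_sq P"
  unfolding ls_sq_eq_Inf
proof (rule cInf_greatest[OF ls_set_nonempty[OF assms(3)]])
  fix l assume "l \<in> ls_set P"
  then obtain f where f: "aff_unimodular f" "f ` P \<subseteq> {0..l} \<times> {0..l}" by (auto simp: ls_set_def)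
  obtain a b c d v1 v2 :: int where det: "a * d - b * c = 1 \<or> a * d - b * c = -1"
    and fe: "f = (\<lambda>(x, y). (of_int a * x + of_int b * y + of_int v1, of_int c * x + of_int d * y + of_int v2))"
    using f(1) unfolding aff_unimodular_def by blast
  obtain z w where zw: "z \<in> T" "w \<in> T" "h \<le> \<bar>a * (fst z - fst w) + b * (snd z - snd w)\<bar> \<or>
                     h \<le> \<bar>c * (fst z - fst w) + d * (snd z - snd w)\<bar>"
    using assms(1) det unfolding wide_def by metis
  have "f (emb z) \<in> {0..l} \<times> {0..l}" "f (emb w) \<in> {0..l} \<times> {0..l}"
    using f(2) zw assms(2) by blast+
  then have "\<bar>real_of_int a * (of_int (fst z) - of_int (fst w)) + of_int b * (of_int (snd z) - of_int (snd w))\<bar> \<le> l"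
    "\<bar>real_of_int c * (of_int (fst z) - of_int (fst w)) + of_int d * (of_int (snd z) - of_int (snd w))\<bar> \<le> l"
    by (auto simp: fe emb_def algebra_simps)
  then have "real_of_int \<bar>a * (fst z - fst w) + b * (snd z - snd w)\<bar> \<le> l"
    "real_of_int \<bar>c * (fst z - fst w) + d * (snd z - snd w)\<bar> \<le> l"
    by (simp_all only: of_int_abs of_int_add of_int_mult of_int_diff)
  then show "of_int h \<le> l" using zw(3) by (metis of_int_le_iff order_trans)
qed

text \<open>By contraposition: two rows with all differences below \<open>h\<close> give, after
  translating their minima to 0, a map into a square of side \<open>h - 1\<close>.\<close>

lemma wide_of_ls_ge:
  assumes "finite S" "S \<noteq> {}" "of_int h \<le> ls_sq (convex hull (emb ` S))" "h \<ge> 1"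
  shows "wide h S"
  unfolding wide_def
proof (intro allI impI, rule ccontr)
  fix a b c d :: int
  assume det: "a * d - b * c = 1 \<or> a * d - b * c = -1"
  assume no: "\<not> (\<exists>z\<in>S. \<exists>w\<in>S. h \<le> \<bar>a * (fst z - fst w) + b * (snd z - snd w)\<bar> \<or>
                     h \<le> \<bar>c * (fst z - fst w) + d * (snd z - snd w)\<bar>)"
  define F where "F = (\<lambda>p::int\<times>int. a * fst p + b * snd p)"
  define G where "G = (\<lambda>p::int\<times>int. c * fst p + d * snd p)"
  obtain m where m: "m \<in> S" "\<And>p. p \<in> S \<Longrightarrow> F m \<le> F p"
    using assms(1,2) by (metis arg_min_if_finite(1) arg_min_least)
  obtain k where k: "k \<in> S" "\<And>p. p \<in> S \<Longrightarrow> G k \<le> G p"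
    using assms(1,2) by (metis arg_min_if_finite(1) arg_min_least)
  define f :: "pt \<Rightarrow> pt" where "f = (\<lambda>(x, y). (of_int a * x + of_int b * y + of_int (- F m),
                        of_int c * x + of_int d * y + of_int (- G k)))"
  have f: "aff_unimodular f" unfolding f_def by (rule aff_unimodularI[OF det])
  \<comment> \<open>Integrality turns \<open>< h\<close> into \<open>\<le> h - 1\<close>. Without
    this gap the infimum could still equal \<open>h\<close>.\<close>
  have "f (emb p) \<in> {0..of_int (h - 1)} \<times> {0..of_int (h - 1)}" if "p \<in> S" for p
  proof -
    have "\<bar>F p - F m\<bar> < h" "\<bar>G p - G k\<bar> < h"
      using no that m(1) k(1) unfolding F_def G_def by (force simp: algebra_simps)+
    then have "F p - F m \<in> {0..h-1}" "G p - G k \<in> {0..h-1}" using m(2)[OF that] k(2)[OF that] by auto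
    moreover have "f (emb p) = (of_int (F p - F m), of_int (G p - G k))"
      by (simp add: f_def F_def G_def emb_def)
    ultimately show ?thesis by (simp del: of_int_diff)
  qed
  then have "f ` emb ` S \<subseteq> {0..of_int (h - 1)} \<times> {0..of_int (h - 1)}" by blast
  then have "f ` (convex hull (emb ` S)) \<subseteq> {0..of_int (h - 1)} \<times> {0..of_int (h - 1)}"
    unfolding aff_unimodular_convex_hull[OF f]
    by (rule hull_minimal) (intro convex_Times convex_real_interval)
  then have "of_int (h - 1) \<in> ls_set (convex hull (emb ` S))"
    unfolding ls_set_def using f assms(4) by auto
  then have "ls_sq (convex hull (emb ` S)) \<le> of_int (h - 1)"
    unfolding ls_sq_eq_Inf by (rule cInf_lower[OF _ bdd_below_ls_set])
  then show False using assms(3) by simp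
qed

section \<open>Minimal polygons\<close>

definition minimal_of_size :: "int \<Rightarrow> pt set \<Rightarrow> bool" where
  "minimal_of_size h P \<longleftrightarrow> h \<ge> 1 \<and> ls_sq P = of_int h \<and> minimal_lp P"

lemma minimal_of_size_image:
  assumes "aff_unimodular f" "minimal_of_size h P"
  shows "minimal_of_size h (f ` P)"
proof -
  obtain g where g: "aff_unimodular g" "\<And>x. g (f x) = x" "\<And>x. f (g x) = x"
    using aff_unimodular_inverse[OF assms(1)] by blast
  have "ls_sq Q \<noteq> ls_sq (f ` P)" if Q: "lattice_polygon Q" "Q \<subset> f ` P" for Q
  proof -
    have "f ` g ` Q = Q" "g ` f ` P = P" using g by (simp_all add: image_image)
    then have "g ` Q \<subset> P" using Q(2) by (metis image_mono psubset_eq)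
    then have "ls_sq (g ` Q) \<noteq> ls_sq P"
      using assms(2) aff_unimodular_lattice_polygon[OF g(1) Q(1)]
      unfolding minimal_of_size_def minimal_lp_def by blast
    then show ?thesis using ls_sq_image g(1) assms(1) by metis
  qed
  then show ?thesis
    using assms aff_unimodular_lattice_polygon
    by (simp add: minimal_of_size_def minimal_lp_def ls_sq_image)
qed

text \<open>The hull of \<open>T\<close> has size at least \<open>h\<close> by wideness and at most
  \<open>h\<close> by monotonicity, so minimality forbids it to be a proper subset. Minimality acts
  on the later geometric arguments only through this fact.\<close>

lemma minimal_eq_hull_of_wide:
  assumes "minimal_of_size h P" "wide h T" "finite T" "emb ` T \<subseteq> P"
  shows "P = convex hull (emb ` T)"
proof -
  have P: "lattice_polygon P" "ls_sq P = of_int h"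
    and min: "\<And>Q. lattice_polygon Q \<Longrightarrow> Q \<subset> P \<Longrightarrow> ls_sq Q \<noteq> ls_sq P"
    using assms(1) by (auto simp: minimal_of_size_def minimal_lp_def)
  have "T \<noteq> {}" using assms(2) unfolding wide_def
    by (metis diff_zero empty_iff mult_1 mult_zero_left)
  then have Q: "lattice_polygon (convex hull (emb ` T))"
    using assms(3) lattice_polygon_iff_emb by blast
  have "convex P" using P(1) by (auto simp: lattice_polygon_def)
  then have sub: "convex hull (emb ` T) \<subseteq> P" using assms(4) by (simp add: hull_minimal)
  have "of_int h \<le> ls_sq (convex hull (emb ` T))"
    by (rule wide_imp_ls_ge[OF assms(2) _ Q]) (simp add: hull_subset)
  moreover have "ls_sq (convex hull (emb ` T)) \<le> of_int h"
    using cInf_superset_mono[OF ls_set_nonempty[OF P(1)] bdd_below_ls_set ls_set_mono[OF sub]] P(2)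
    by (simp add: ls_sq_eq_Inf)
  ultimately show ?thesis using min[OF Q] sub P(2) by force
qed


section \<open>Sufficient conditions for wideness\<close>

lemma abs_combination_ge:
  fixes i j h e :: int
  assumes "\<bar>j\<bar> < \<bar>i\<bar>" "\<bar>e\<bar> \<le> h"
  shows "h \<le> \<bar>i * h + j * e\<bar>"
proof -
  have "\<bar>j * e\<bar> \<le> \<bar>j\<bar> * h" using assms(2) by (simp add: abs_mult mult_left_mono)
  moreover have "\<bar>i * h\<bar> = \<bar>i\<bar> * h" using assms(2) by (simp add: abs_mult)
  moreover have "(\<bar>j\<bar> + 1) * h \<le> \<bar>i\<bar> * h" using assms by (intro mult_right_mono) auto
  ultimately show ?thesis unfolding distrib_right by linarith
qed

text \<open>With respect to a norm in which both coordinate functionals have length \<open>h\<close>, a functional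
  \<open>i x + j y\<close> shorter than \<open>h\<close> has \<open>\<bar>i\<bar> = \<bar>j\<bar>\<close>; two such functionals have even determinant.\<close>

lemma wide_of_touching_four_sides:
  assumes zw: "z \<in> T" "w \<in> T" "fst z - fst w = h" "\<bar>snd z - snd w\<bar> \<le> h"
    and zw': "z' \<in> T" "w' \<in> T" "snd z' - snd w' = h" "\<bar>fst z' - fst w'\<bar> \<le> h"
  shows "wide h T"
proof -
  have short: "\<bar>i\<bar> = \<bar>j\<bar>"
    if "\<not> (\<exists>z\<in>T. \<exists>w\<in>T. h \<le> \<bar>i * (fst z - fst w) + j * (snd z - snd w)\<bar>)" for i j
  proof -
    have "\<not> h \<le> \<bar>i * h + j * (snd z - snd w)\<bar>" using that zw by metis
    moreover have "\<not> h \<le> \<bar>j * h + i * (fst z' - fst w')\<bar>" using that zw' by (metis add.commute)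
    ultimately show ?thesis
      using abs_combination_ge zw(4) zw'(4) by (meson linorder_neqE)
  qed
  show ?thesis
    unfolding wide_def
  proof (intro allI impI, rule ccontr)
    fix a b c d :: int
    assume det: "a * d - b * c = 1 \<or> a * d - b * c = -1"
    assume no: "\<not> (\<exists>z\<in>T. \<exists>w\<in>T. h \<le> \<bar>a * (fst z - fst w) + b * (snd z - snd w)\<bar> \<or>
                     h \<le> \<bar>c * (fst z - fst w) + d * (snd z - snd w)\<bar>)"
    have "\<bar>a\<bar> = \<bar>b\<bar>" "\<bar>c\<bar> = \<bar>d\<bar>" using no by (auto intro!: short)
    \<comment> \<open>Modulo 2, \<open>a = b\<close> and \<open>c = d\<close>, hence
      \<open>a * d = b * c\<close>.\<close>
    then have "even (a * d - b * c)" by (metis dvd_abs_iff dvd_diff_commute even_diff even_mult_iff even_add)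
    then show False using det by (metis even_minus odd_one)
  qed
qed

text \<open>If \<open>i\<close> dominates, the pair spanning the full horizontal width works.
  Otherwise the sign of \<open>i * j\<close> selects the diagonal or the antidiagonal pair, for
  which the two terms add up without cancellation.\<close>

lemma exists_wide_difference:
  fixes h i j :: int
  assumes T: "T \<subseteq> {0..h} \<times> {0..h}"
    and zw: "z \<in> T" "w \<in> T" "fst z - fst w = h"
    and plus: "z1 \<in> T" "w1 \<in> T" "h \<le> (fst z1 + snd z1) - (fst w1 + snd w1)"
    and minus: "z2 \<in> T" "w2 \<in> T" "h \<le> (fst z2 - snd z2) - (fst w2 - snd w2)"
    and i: "i \<noteq> 0"
  shows "\<exists>z\<in>T. \<exists>w\<in>T. h \<le> \<bar>i * (fst z - fst w) + j * (snd z - snd w)\<bar>"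
proof (cases "\<bar>j\<bar> < \<bar>i\<bar>")
  case True
  have "\<bar>snd z - snd w\<bar> \<le> h" using subsetD[OF T zw(1)] subsetD[OF T zw(2)] by (auto simp: mem_Times_iff abs_le_iff)
  from abs_combination_ge[OF True this] zw show ?thesis by metis
next
  case False
  \<comment> \<open>Here \<open>i * x\<close> and \<open>j * y\<close> have compatible signs, so the
    absolute value is \<open>\<bar>i\<bar> * \<bar>x\<bar> + \<bar>j\<bar> * \<bar>y\<bar>\<close>,
    which is at least \<open>\<bar>x\<bar> + \<bar>y\<bar>\<close>.\<close>
  have dom: "h \<le> \<bar>i * x + j * y\<bar>"
    if "x \<ge> 0" "y \<ge> 0 \<and> i * j > 0 \<and> h \<le> x + y \<or> y \<le> 0 \<and> i * j < 0 \<and> h \<le> x - y" for x y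
  proof -
    have "\<bar>i * x + j * y\<bar> = \<bar>i\<bar> * \<bar>x\<bar> + \<bar>j\<bar> * \<bar>y\<bar>"
    proof -
      have "0 \<le> (i * j) * (x * y)"
        using that by (auto intro: mult_nonneg_nonneg mult_nonpos_nonpos simp: mult_nonneg_nonpos)
      then have "0 \<le> (i * x) * (j * y)" by (simp add: mult_ac)
      then show ?thesis by (auto simp: abs_mult[symmetric] zero_le_mult_iff)
    qed
    moreover have "1 * \<bar>x\<bar> \<le> \<bar>i\<bar> * \<bar>x\<bar>" "1 * \<bar>y\<bar> \<le> \<bar>j\<bar> * \<bar>y\<bar>"
      by (rule mult_right_mono; use i False in linarith)+
    ultimately show ?thesis using that by auto
  qed
  have bd: "p \<in> T \<Longrightarrow> 0 \<le> fst p \<and> fst p \<le> h \<and> 0 \<le> snd p \<and> snd p \<le> h" for p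
    using subsetD[OF T, of p] by (auto simp: mem_Times_iff)
  have "i * j \<noteq> 0" using i False by auto
  then have "i * j > 0 \<or> i * j < 0" by linarith
  then show ?thesis
  proof
    assume "i * j > 0"
    \<comment> \<open>Inside the square each coordinate difference is at most \<open>h\<close>; a
      sum of at least \<open>h\<close> therefore makes both nonnegative.\<close>
    then have "h \<le> \<bar>i * (fst z1 - fst w1) + j * (snd z1 - snd w1)\<bar>"
      using plus bd[of z1] bd[of w1] by (intro dom) auto
    then show ?thesis using plus by blast
  next
    assume "i * j < 0"
    then have "h \<le> \<bar>i * (fst z2 - fst w2) + j * (snd z2 - snd w2)\<bar>"
      using minus bd[of z2] bd[of w2] by (intro dom) auto
    then show ?thesis using minus by blast
  qed
qed

text \<open>Neither column of a unimodular matrix vanishes, so some row has a nonzero coefficient at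
  the coordinate of full width. Unlike the four-sides criterion, this one also applies to sets that
  miss a side of the square.\<close>

lemma wide_of_sum_diff:
  assumes T: "T \<subseteq> {0..h} \<times> {0..h}"
    and zw: "\<exists>z\<in>T. \<exists>w\<in>T. fst z - fst w = h \<or> snd z - snd w = h"
    and plus: "\<exists>z\<in>T. \<exists>w\<in>T. h \<le> (fst z + snd z) - (fst w + snd w)"
    and minus: "\<exists>z\<in>T. \<exists>w\<in>T. h \<le> (fst z - snd z) - (fst w - snd w)"
  shows "wide h T"
  unfolding wide_def
proof (intro allI impI)
  fix a b c d :: int
  assume det: "a * d - b * c = 1 \<or> a * d - b * c = -1"
  obtain z1 w1 where 1: "z1 \<in> T" "w1 \<in> T" "h \<le> (fst z1 + snd z1) - (fst w1 + snd w1)"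
    using plus by blast
  obtain z2 w2 where 2: "z2 \<in> T" "w2 \<in> T" "h \<le> (fst z2 - snd z2) - (fst w2 - snd w2)"
    using minus by blast
  obtain z w where zw: "z \<in> T" "w \<in> T" "fst z - fst w = h \<or> snd z - snd w = h"
    using zw by blast
  show "\<exists>z\<in>T. \<exists>w\<in>T. h \<le> \<bar>a * (fst z - fst w) + b * (snd z - snd w)\<bar> \<or>
                     h \<le> \<bar>c * (fst z - fst w) + d * (snd z - snd w)\<bar>"
  proof (cases "fst z - fst w = h")
    case True
    have "a \<noteq> 0 \<or> c \<noteq> 0" using det by auto
    then show ?thesis using exists_wide_difference[OF T zw(1,2) True 1 2] by blast
  next
    case False
    have sw: "p \<in> T \<Longrightarrow> prod.swap p \<in> prod.swap ` T" for p by blast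
    have "prod.swap ` T \<subseteq> {0..h} \<times> {0..h}" using T by auto
    \<comment> \<open>Swapping the coordinates negates \<open>x - y\<close>, so the points of the
      second pair trade places.\<close>
    from exists_wide_difference[OF this sw[OF zw(1)] sw[OF zw(2)] _ sw[OF 1(1)] sw[OF 1(2)] _
        sw[OF 2(2)] sw[OF 2(1)]] zw(3) False 1(3) 2(3)
    have "\<exists>z\<in>T. \<exists>w\<in>T. h \<le> \<bar>j * (snd z - snd w) + i * (fst z - fst w)\<bar>" if "j \<noteq> 0" for i j
      using that by auto
    then have "\<exists>z\<in>T. \<exists>w\<in>T. h \<le> \<bar>i * (fst z - fst w) + j * (snd z - snd w)\<bar>" if "j \<noteq> 0" for i j
      using that by (metis add.commute)
    moreover have "b \<noteq> 0 \<or> d \<noteq> 0" using det by auto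
    ultimately show ?thesis by blast
  qed
qed

section \<open>The list of normal forms and the segment case\<close>

definition in_list :: "int \<Rightarrow> pt set \<Rightarrow> bool" where
  "in_list h P \<longleftrightarrow> lattice_equiv P (convex hull {(0, 0), (of_int h, 0)})
    \<or> (\<exists>a b :: int. 1 \<le> a \<and> a \<le> h - 1 \<and> 1 \<le> b \<and> b \<le> h - 1 \<and> a + b \<ge> h \<and>
         lattice_equiv P (convex hull {(0, 0), (of_int a, of_int h), (of_int h, of_int b)}))
    \<or> (\<exists>a b c d :: int. 1 \<le> a \<and> a \<le> h - 1 \<and> 1 \<le> b \<and> b \<le> h - 1 \<and>
         1 \<le> c \<and> c \<le> h - 1 \<and> 1 \<le> d \<and> d \<le> h - 1 \<and> min a b + min c d > h \<and>
         lattice_equiv P (convex hull {(of_int a, 0), (0, of_int b),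
                                       (of_int h, of_int (h - c)), (of_int (h - d), of_int h)}))"

lemma lattice_equiv_refl: "lattice_equiv P P"
  unfolding lattice_equiv_def using aff_unimodular_id by (metis image_id id_apply)

lemma in_list_of_image:
  assumes "aff_unimodular f" "in_list h (f ` P)"
  shows "in_list h P"
proof -
  have "lattice_equiv P Q" if "lattice_equiv (f ` P) Q" for Q
    using that aff_unimodular_comp[OF assms(1)] unfolding lattice_equiv_def by (metis image_comp)
  then show ?thesis using assms(2) unfolding in_list_def by blast
qed

text \<open>The Bezout relation makes \<open>(i, j)\<close> primitive, so the segment from
  \<open>z\<close> to \<open>w\<close> has lattice length \<open>h\<close>. An invertible matrix
  does not annihilate \<open>(i, j)\<close>, hence some row takes a nonzero multiple of
  \<open>h\<close> on the segment.\<close>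

lemma in_list_of_segment:
  assumes P: "minimal_of_size h P" and zw: "emb z \<in> P" "emb w \<in> P"
    and ij: "fst w - fst z = h * i" "snd w - snd z = h * j" "k * i + l * j = 1"
  shows "in_list h P"
proof -
  have h: "h \<ge> 1" using P by (simp add: minimal_of_size_def)
  have "wide h {w, z}"
    unfolding wide_def
  proof (intro allI impI)
    fix a b c d :: int
    assume det: "a * d - b * c = 1 \<or> a * d - b * c = -1"
    have "a * i + b * j \<noteq> 0 \<or> c * i + d * j \<noteq> 0"
    proof (rule ccontr)
      assume "\<not> ?thesis"
      then have "(a * d - b * c) * i = 0" "(a * d - b * c) * j = 0" by algebra+
      then have "i = 0" "j = 0" using det by auto
      then show False using ij(3) by simp
    qed
    moreover have "h \<le> \<bar>e * (fst w - fst z) + g * (snd w - snd z)\<bar>" if "e * i + g * j \<noteq> 0" for e g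
    proof -
      have "e * (fst w - fst z) + g * (snd w - snd z) = h * (e * i + g * j)"
        unfolding ij by algebra
      moreover have "h * 1 \<le> h * \<bar>e * i + g * j\<bar>" using that h by (intro mult_left_mono) auto
      ultimately show ?thesis using h by (simp add: abs_mult)
    qed
    ultimately show "\<exists>z'\<in>{w, z}. \<exists>w'\<in>{w, z}. h \<le> \<bar>a * (fst z' - fst w') + b * (snd z' - snd w')\<bar> \<or>
                     h \<le> \<bar>c * (fst z' - fst w') + d * (snd z' - snd w')\<bar>"
      by (meson insertCI)
  qed
  then have hull: "P = convex hull (emb ` {w, z})"
    using zw by (intro minimal_eq_hull_of_wide[OF P]) auto
  \<comment> \<open>The rows \<open>(k, l)\<close> and \<open>(-j, i)\<close> have determinant
    \<open>k * i + l * j = 1\<close>; the map sends \<open>z\<close> to the origin and the direction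
    \<open>(i, j)\<close> to \<open>(1, 0)\<close>.\<close>
  define f :: "pt \<Rightarrow> pt" where "f = (\<lambda>(x, y). (of_int k * x + of_int l * y + of_int (- k * fst z - l * snd z),
                        of_int (- j) * x + of_int i * y + of_int (j * fst z - i * snd z)))"
  have f: "aff_unimodular f" unfolding f_def
    by (rule aff_unimodularI) (use ij(3) in \<open>simp add: algebra_simps\<close>)
  have w: "fst w = fst z + h * i" "snd w = snd z + h * j" using ij by auto
  have kl: "real_of_int k * of_int i + of_int l * of_int j = 1"
    using ij(3) by (metis of_int_1 of_int_add of_int_mult)
  have "f (emb w) = (of_int h * (real_of_int k * of_int i + of_int l * of_int j), 0)"
    by (simp add: f_def emb_def w algebra_simps)
  moreover have "f (emb z) = (0, 0)" by (simp add: f_def emb_def)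
  ultimately have "f ` P = convex hull {(0, 0), (of_int h, 0)}"
    unfolding hull aff_unimodular_convex_hull[OF f] kl by (simp add: insert_commute)
  then show ?thesis using f unfolding in_list_def lattice_equiv_def by blast
qed

section \<open>Points of convex sets and removal of a vertex\<close>

lemma horizontal_mem_convex:
  assumes "convex (P :: pt set)" "(x1, y) \<in> P" "(x2, y) \<in> P" "x1 \<le> x" "x \<le> x2"
  shows "(x, y) \<in> P"
proof (cases "x1 = x2")
  case False
  then have lt: "x1 < x2" using assms by simp
  define t where "t = (x - x1) / (x2 - x1)"
  have t: "0 \<le> t" "t \<le> 1" "t * (x2 - x1) = x - x1" using assms lt by (auto simp: t_def)
  have "(1 - t) *\<^sub>R (x1, y) + t *\<^sub>R (x2, y) \<in> P"
    using assms t by (intro convexD) auto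
  moreover have "(1 - t) *\<^sub>R (x1, y) + t *\<^sub>R (x2, y) = (x, y)"
    using t(3) by (simp add: algebra_simps)
  ultimately show ?thesis by simp
qed (use assms in auto)

text \<open>The point of the segment \<open>pq\<close> at integer height \<open>y\<close>; its
  abscissa may be fractional, so it only serves as an end of a horizontal segment containing lattice
  points.\<close>

lemma slanted_mem_convex:
  assumes "convex P" "emb p \<in> P" "emb q \<in> P" "snd q - snd p = h" "h \<ge> 1"
    and "snd p \<le> y" "y \<le> snd q"
  shows "(of_int (fst p) + of_int (y - snd p) * of_int (fst q - fst p) / of_int h, of_int y) \<in> P"
proof -
  define t where "t = real_of_int (y - snd p) / of_int h"
  have th: "t * of_int h = of_int y - of_int (snd p)" using assms(5) by (simp add: t_def)
  have t: "0 \<le> t" "t \<le> 1" using assms by (auto simp: t_def)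
  have "(1 - t) *\<^sub>R emb p + t *\<^sub>R emb q \<in> P"
    using assms t by (intro convexD) auto
  moreover have "(1 - t) *\<^sub>R emb p + t *\<^sub>R emb q
    = (of_int (fst p) + t * of_int (fst q - fst p), of_int (snd p) + t * of_int (snd q - snd p))"
    by (simp add: emb_def algebra_simps)
  ultimately show ?thesis
    unfolding assms(4) th by (simp add: t_def)
qed

lemma emb_mem_hull_le:
  assumes "emb q \<in> convex hull (emb ` T)" "\<And>p. p \<in> T \<Longrightarrow> u * fst p + v * snd p \<le> m"
  shows "u * fst q + v * snd q \<le> m"
proof -
  define H where "H = {p :: pt. (of_int u, of_int v) \<bullet> p \<le> of_int m}"
  have emb_H: "emb p \<in> H \<longleftrightarrow> u * fst p + v * snd p \<le> m" for p
  proof -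
    have "(of_int u, of_int v) \<bullet> emb p = of_int (u * fst p + v * snd p)" by (simp add: emb_def)
    then show ?thesis unfolding H_def by (simp del: of_int_add of_int_mult)
  qed
  have "convex hull (emb ` T) \<subseteq> H"
    using assms(2) emb_H by (intro hull_minimal) (auto simp: H_def convex_halfspace_le)
  then show ?thesis using assms(1) emb_H by blast
qed

text \<open>A wide \<open>T\<close> would span \<open>P\<close>, but a half-plane containing
  \<open>T\<close> misses \<open>q\<close>. Integrality makes the strict bound a closed one with
  \<open>- 1\<close>.\<close>

lemma not_wide_of_halfplane:
  assumes "minimal_of_size h P" "emb q \<in> P" "finite T" "emb ` T \<subseteq> P"
    and "\<And>p. p \<in> T \<Longrightarrow> u * fst p + v * snd p < u * fst q + v * snd q"
  shows "\<not> wide h T"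
proof
  assume "wide h T"
  then have "emb q \<in> convex hull (emb ` T)"
    using minimal_eq_hull_of_wide assms(1-4) by blast
  from emb_mem_hull_le[OF this, of u v "u * fst q + v * snd q - 1"] assms(5) show False by force
qed

lemma convex_minimal_of_size: "minimal_of_size h P \<Longrightarrow> convex P"
  by (auto simp: minimal_of_size_def minimal_lp_def lattice_polygon_def)

lemma minimal_of_size_transform:
  fixes a b c d v w :: int
  assumes "minimal_of_size h P" "a * d - b * c = 1 \<or> a * d - b * c = -1"
  obtains f where "aff_unimodular f" "minimal_of_size h (f ` P)"
    "\<And>x y. emb (x, y) \<in> P \<Longrightarrow> emb (a * x + b * y + v, c * x + d * y + w) \<in> f ` P"
    "\<And>x y. f (emb (x, y)) = emb (a * x + b * y + v, c * x + d * y + w)"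
proof -
  define f :: "pt \<Rightarrow> pt" where "f = (\<lambda>(x, y). (of_int a * x + of_int b * y + of_int v,
                                   of_int c * x + of_int d * y + of_int w))"
  have f: "aff_unimodular f" unfolding f_def by (rule aff_unimodularI[OF assms(2)])
  have fe: "f (emb (x, y)) = emb (a * x + b * y + v, c * x + d * y + w)" for x y
    by (simp add: f_def emb_def)
  show ?thesis
    by (rule that[OF f minimal_of_size_image[OF f assms(1)] _ fe]) (simp flip: fe)
qed

section \<open>Polygons touching all four sides of the square\<close>

text \<open>If \<open>a\<close> or \<open>b\<close> is 0 or \<open>h\<close>, two of the points span
  a segment of lattice length \<open>h\<close>. Otherwise the three points are wide and span
  \<open>P\<close>, and only \<open>a + b < h\<close> has to be excluded.\<close>

lemma in_list_of_corner:
  assumes P: "minimal_of_size h P"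
    and mem: "emb (0, 0) \<in> P" "emb (a, h) \<in> P" "emb (h, b) \<in> P"
    and ab: "0 \<le> a" "a \<le> h" "0 \<le> b" "b \<le> h"
  shows "in_list h P"
proof -
  have h: "h \<ge> 1" using P by (simp add: minimal_of_size_def)
  consider "a = 0" | "b = 0" | "a = h" | "b = h" | "0 < a" "a < h" "0 < b" "b < h"
    using ab by linarith
  then show ?thesis
  proof cases
    case 1
    then show ?thesis using in_list_of_segment[OF P mem(1,2), of 0 1 0 1] by simp
  next
    case 2
    then show ?thesis using in_list_of_segment[OF P mem(1,3), of 1 0 1 0] by simp
  next
    case 3
    then show ?thesis using in_list_of_segment[OF P mem(1,2), of 1 1 1 0] by simp
  next
    case 4
    then show ?thesis using in_list_of_segment[OF P mem(1,3), of 1 1 1 0] by simp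
  next
    case 5
    let ?T = "{(0, 0), (a, h), (h, b)}"
    have "wide h ?T"
      by (rule wide_of_touching_four_sides[of "(h, b)" _ "(0, 0)" _ "(a, h)" "(0, 0)"]) (use 5 in auto)
    then have hull: "P = convex hull (emb ` ?T)"
      using mem by (intro minimal_eq_hull_of_wide[OF P]) auto
    have "a + b \<ge> h"
    proof (rule ccontr)
      assume lt: "\<not> a + b \<ge> h"
      \<comment> \<open>The vertex \<open>(h, b)\<close> can be replaced by the lattice point \<open>(a + b, b)\<close>.\<close>
      have left: "(of_int (0 + b * a) / of_int h, of_int b) \<in> P"
        using slanted_mem_convex[OF convex_minimal_of_size[OF P] mem(1,2) _ h, of b] 5 by simp
      have right: "(of_int h, of_int b) \<in> P" using mem(3) by (simp add: emb_def)
      \<comment> \<open>The edge from the origin to \<open>(a, h)\<close> has abscissa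
        \<open>a * b / h\<close> at height \<open>b\<close>, which is at most
        \<open>a\<close>.\<close>
      have "real_of_int (0 + b * a) / of_int h \<le> of_int (a + b)"
      proof -
        have "b * a \<le> h * a" using 5 by (intro mult_right_mono) auto
        moreover have "0 \<le> b * h" using 5 by simp
        ultimately have "b * a \<le> (a + b) * h" unfolding distrib_right by (simp add: mult.commute)
        then have "real_of_int (b * a) \<le> of_int (a + b) * of_int h"
          by (metis of_int_le_iff of_int_mult)
        then show ?thesis using h by (simp add: divide_le_eq)
      qed
      then have "(of_int (a + b), of_int b) \<in> P"
        using lt by (intro horizontal_mem_convex[OF convex_minimal_of_size[OF P] left right]) auto
      then have mem': "emb (a + b, b) \<in> P" by (simp add: emb_def)
      \<comment> \<open>The abscissa \<open>a + b\<close> is chosen so that \<open>x - y\<close>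
        equals \<open>a\<close> at the new point, exactly \<open>h\<close> more than at
        \<open>(a, h)\<close>. The pair \<open>(0, 0)\<close>, \<open>(a, h)\<close> serves for
        \<open>y\<close> and \<open>x + y\<close>.\<close>
      have "wide h {(0, 0), (a, h), (a + b, b)}"
        by (rule wide_of_sum_diff) (use 5 lt in auto)
      moreover have "\<not> wide h {(0, 0), (a, h), (a + b, b)}"
        by (rule not_wide_of_halfplane[OF P mem(3), where u = 1 and v = 0]) (use 5 lt mem mem' in auto)
      ultimately show False by blast
    qed
    moreover have "P = convex hull {(0, 0), (of_int a, of_int h), (of_int h, of_int b)}"
      unfolding hull by (simp add: emb_def)
    ultimately show ?thesis
      unfolding in_list_def using 5 lattice_equiv_refl[of P] by (metis int_one_le_iff_zero_less zle_diff1_eq)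
  qed
qed

lemma in_list_of_touching_four_sides:
  assumes P: "minimal_of_size h P"
    and mem: "emb (a, 0) \<in> P" "emb (0, b) \<in> P" "emb (h, h - c) \<in> P" "emb (h - d, h) \<in> P"
    and ab: "0 \<le> a" "a \<le> h" "0 \<le> b" "b \<le> h" "0 \<le> c" "c \<le> h" "0 \<le> d" "d \<le> h"
  shows "in_list h P"
proof -
  have h: "h \<ge> 1" using P by (simp add: minimal_of_size_def)
  \<comment> \<open>The first four cases are the corners \<open>(0, 0)\<close>,
    \<open>(h, 0)\<close>, \<open>(0, h)\<close>, \<open>(h, h)\<close>; reflections move the last
    three to the origin.\<close>
  consider "a = 0 \<or> b = 0" | "a = h \<or> c = h" | "b = h \<or> d = h" | "c = 0 \<or> d = 0"
    | "0 < a" "a < h" "0 < b" "b < h" "0 < c" "c < h" "0 < d" "d < h"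
    using ab by linarith
  then show ?thesis
  proof cases
    case 1
    then have "emb (0, 0) \<in> P" using mem by auto
    then show ?thesis using in_list_of_corner[OF P _ mem(4,3)] ab by simp
  next
    case 2
    then have "emb (h, 0) \<in> P" using mem by auto
    moreover obtain f where f: "aff_unimodular f" "minimal_of_size h (f ` P)"
      "\<And>x y. emb (x, y) \<in> P \<Longrightarrow> emb (-1 * x + 0 * y + h, 0 * x + 1 * y + 0) \<in> f ` P"
      by (rule minimal_of_size_transform[OF P, of "-1" 1 0 0 h 0]) auto
    ultimately have "in_list h (f ` P)"
      using in_list_of_corner[OF f(2), of d b] f(3)[of h 0] f(3)[OF mem(4)] f(3)[OF mem(2)] ab by simp
    then show ?thesis using in_list_of_image f(1) by blast
  next
    case 3
    then have "emb (0, h) \<in> P" using mem by auto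
    moreover obtain f where f: "aff_unimodular f" "minimal_of_size h (f ` P)"
      "\<And>x y. emb (x, y) \<in> P \<Longrightarrow> emb (1 * x + 0 * y + 0, 0 * x + -1 * y + h) \<in> f ` P"
      by (rule minimal_of_size_transform[OF P, of 1 "-1" 0 0 0 h]) auto
    ultimately have "in_list h (f ` P)"
      using in_list_of_corner[OF f(2), of a c] f(3)[of 0 h] f(3)[OF mem(1)] f(3)[OF mem(3)] ab by simp
    then show ?thesis using in_list_of_image f(1) by blast
  next
    case 4
    then have "emb (h, h) \<in> P" using mem by auto
    moreover obtain f where f: "aff_unimodular f" "minimal_of_size h (f ` P)"
      "\<And>x y. emb (x, y) \<in> P \<Longrightarrow> emb (-1 * x + 0 * y + h, 0 * x + -1 * y + h) \<in> f ` P"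
      by (rule minimal_of_size_transform[OF P, of "-1" "-1" 0 0 h h]) auto
    ultimately have "in_list h (f ` P)"
      using in_list_of_corner[OF f(2), of "h - a" "h - b"] f(3)[of h h] f(3)[OF mem(1)] f(3)[OF mem(2)] ab
      by simp
    then show ?thesis using in_list_of_image f(1) by blast
  next
    case 5
    let ?T = "{(a, 0), (0, b), (h, h - c), (h - d, h)}"
    have "wide h ?T"
      by (rule wide_of_touching_four_sides[of "(h, h - c)" _ "(0, b)" _ "(h - d, h)" "(a, 0)"]) (use 5 in auto)
    then have hull: "P = convex hull (emb ` ?T)"
      using mem by (intro minimal_eq_hull_of_wide[OF P]) auto
    consider "min a b + min c d > h" | "max a c + max b d < h"
      | "min a b + min c d \<le> h" "max a c + max b d \<ge> h" by linarith
    then show ?thesis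
    proof cases
      case 1
      have "lattice_equiv P (convex hull {(of_int a, 0), (0, of_int b),
                                       (of_int h, of_int (h - c)), (of_int (h - d), of_int h)})"
        using lattice_equiv_refl[of P] by (subst (asm) (2) hull) (simp add: emb_def)
      moreover have "1 \<le> a" "a \<le> h - 1" "1 \<le> b" "b \<le> h - 1" "1 \<le> c" "c \<le> h - 1" "1 \<le> d" "d \<le> h - 1"
        using 5 by auto
      ultimately show ?thesis unfolding in_list_def using 1 by blast
    next
      case 2
      \<comment> \<open>The reflection of \<open>x\<close> to \<open>h - x\<close> replaces
        \<open>(a, b, c, d)\<close> by \<open>(h - a, h - c, h - b, h - d)\<close>, turning the
        bound on maxima into the required one on minima.\<close>
      obtain f where f: "aff_unimodular f"
        "\<And>x y. f (emb (x, y)) = emb (-1 * x + 0 * y + h, 0 * x + 1 * y + 0)"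
        by (rule minimal_of_size_transform[OF P, of "-1" 1 0 0 h 0]) auto
      have "f ` emb ` ?T = emb ` {(h - a, 0), (h, b), (0, h - c), (d, h)}"
        by (simp only: image_insert image_empty f(2)) simp
      then have "f ` P = convex hull {(of_int (h - a), 0), (0, of_int (h - c)),
           (of_int h, of_int (h - (h - b))), (of_int (h - (h - d)), of_int h)}"
        unfolding hull aff_unimodular_convex_hull[OF f(1)]
        by (simp only:) (simp add: emb_def insert_commute)
      then have "lattice_equiv P (convex hull {(of_int (h - a), 0), (0, of_int (h - c)),
           (of_int h, of_int (h - (h - b))), (of_int (h - (h - d)), of_int h)})"
        unfolding lattice_equiv_def using f(1) by blast
      moreover have "1 \<le> h - a" "h - a \<le> h - 1" "1 \<le> h - c" "h - c \<le> h - 1"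
        "1 \<le> h - b" "h - b \<le> h - 1" "1 \<le> h - d" "h - d \<le> h - 1"
        "min (h - a) (h - c) + min (h - b) (h - d) > h"
        using 5 2 by auto
      ultimately show ?thesis unfolding in_list_def by blast
    next
      case 3
      \<comment> \<open>All parameters lie strictly between 0 and \<open>h\<close>, so each side
        contains just one of the four points, and no three of them can span
        \<open>P\<close>.\<close>
      have "\<not> wide h {(a, 0), (0, b), (h, h - c)}"
        by (rule not_wide_of_halfplane[OF P mem(4), where u = 0 and v = 1]) (use 5 mem in auto)
      moreover have "\<not> wide h {(a, 0), (0, b), (h - d, h)}"
        by (rule not_wide_of_halfplane[OF P mem(3), where u = 1 and v = 0]) (use 5 mem in auto)
      moreover have "\<not> wide h {(a, 0), (h, h - c), (h - d, h)}"
        by (rule not_wide_of_halfplane[OF P mem(2), where u = "-1" and v = 0]) (use 5 mem in auto)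
      moreover have "\<not> wide h {(0, b), (h, h - c), (h - d, h)}"
        by (rule not_wide_of_halfplane[OF P mem(1), where u = 0 and v = "-1"]) (use 5 mem in auto)
      moreover have "wide h {(a, 0), (0, b), (h, h - c)} \<or> wide h {(a, 0), (0, b), (h - d, h)}
        \<or> wide h {(a, 0), (h, h - c), (h - d, h)} \<or> wide h {(0, b), (h, h - c), (h - d, h)}"
      proof -
        \<comment> \<open>On the four points \<open>x + y\<close> takes the values
          \<open>a, b, 2h - c, 2h - d\<close>, and \<open>x - y\<close> the values
          \<open>a, -b, c, -d\<close>. The case gives one pair among \<open>ac, ad, bc, bd\<close>
          with sum at most \<open>h\<close> and one among \<open>ab, ad, bc, cd\<close> with sum at
          least \<open>h\<close>. They fit into a triple unless they are \<open>ad\<close> and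
          \<open>bc\<close>. Then either \<open>a + c\<close> or \<open>b + d\<close> is at most
          \<open>h\<close>, or the total exceeds \<open>2h\<close> and \<open>a + b\<close> or
          \<open>c + d\<close> exceeds \<open>h\<close>; both alternatives yield a triple.\<close>
        have "wide h {(a, 0), (0, b), (h, h - c)}"
          if "a + c \<le> h \<or> b + c \<le> h" "b + c \<ge> h \<or> a + b \<ge> h"
          by (rule wide_of_sum_diff) (use 5 that in auto)
        moreover have "wide h {(a, 0), (0, b), (h - d, h)}"
          if "a + d \<le> h \<or> b + d \<le> h" "a + d \<ge> h \<or> a + b \<ge> h"
          by (rule wide_of_sum_diff) (use 5 that in auto)
        moreover have "wide h {(a, 0), (h, h - c), (h - d, h)}"
          if "a + c \<le> h \<or> a + d \<le> h" "a + d \<ge> h \<or> c + d \<ge> h"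
          by (rule wide_of_sum_diff) (use 5 that in auto)
        moreover have "wide h {(0, b), (h, h - c), (h - d, h)}"
          if "b + c \<le> h \<or> b + d \<le> h" "b + c \<ge> h \<or> c + d \<ge> h"
          by (rule wide_of_sum_diff) (use 5 that in auto)
        ultimately show ?thesis using 3 unfolding min_def max_def by (smt (verit))
      qed
      ultimately show ?thesis by blast
    qed
  qed
qed

section \<open>Polygons of full height only\<close>

text \<open>The functionals \<open>y\<close> and \<open>y - x\<close> form a basis. Once
  \<open>r\<close> and \<open>s\<close> are moved so that \<open>y - x\<close> varies by exactly
  \<open>h\<close>, this basis as coordinates puts the four points on the four sides of a
  square.\<close>

lemma in_list_of_skew:
  assumes P: "minimal_of_size h P"
    and mem: "emb p \<in> P" "emb q \<in> P" "emb r \<in> P" "emb s \<in> P"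
    and pq: "snd q - snd p = h" "0 \<le> fst q - fst p" "fst q - fst p < h"
    and rs: "snd p \<le> snd r" "snd r \<le> snd q" "snd p \<le> snd s" "snd s \<le> snd q"
    and F: "snd q - fst q \<le> snd r - fst r" "snd s - fst s \<le> snd p - fst p"
      "h \<le> (snd r - fst r) - (snd s - fst s)"
  shows "in_list h P"
proof (cases "fst q = fst p")
  case True
  then show ?thesis using in_list_of_segment[OF P mem(1,2), of 0 1 0 1] pq(1) by simp
next
  case False
  have h: "h \<ge> 1" using P by (simp add: minimal_of_size_def)
  note cvx = convex_minimal_of_size[OF P]
  \<comment> \<open>Moving \<open>r\<close> and \<open>s\<close> horizontally towards the segment \<open>pq\<close> stays inside \<open>P\<close> and keeps them
    integral; \<open>M\<close> and \<open>N\<close> are the new values of \<open>y - x\<close>, now exactly \<open>h\<close> apart.\<close>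
  define N where "N = max (snd s - fst s) (snd q - fst q - h)"
  define M where "M = N + h"
  \<comment> \<open>\<open>N\<close> is the least level allowed by \<open>s\<close> and, through
    \<open>M\<close>, by \<open>q\<close>. It stays below the level of \<open>p\<close> because
    \<open>q\<close> is not to the left of \<open>p\<close>, and \<open>M\<close> stays below that
    of \<open>r\<close> because \<open>r\<close> and \<open>s\<close> are at least \<open>h\<close>
    apart.\<close>
  have NM: "snd q - fst q \<le> M" "M \<le> snd r - fst r" "snd s - fst s \<le> N" "N \<le> snd p - fst p"
    using F pq by (auto simp: N_def M_def)
  define d where "d = fst q - fst p"
  have d: "0 \<le> d" "d \<le> h" using pq by (auto simp: d_def)
  \<comment> \<open>The segment \<open>pq\<close> advances horizontally at most as fast as it rises,
    so along it \<open>y - x\<close> stays between its values at \<open>p\<close> and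
    \<open>q\<close>, hence between \<open>N\<close> and \<open>M\<close>.\<close>
  have frac: "0 \<le> real_of_int t * of_int d / of_int h" "real_of_int t * of_int d / of_int h \<le> of_int t"
    "real_of_int d - real_of_int t * of_int d / of_int h \<le> of_int h - of_int t"
    if "0 \<le> t" "t \<le> h" for t
  proof -
    show "0 \<le> real_of_int t * of_int d / of_int h" using that d h by simp
    have "real_of_int t * of_int d \<le> real_of_int t * of_int h"
      using that d by (intro mult_left_mono) auto
    then show "real_of_int t * of_int d / of_int h \<le> of_int t" using h by (simp add: divide_le_eq)
    have "real_of_int (h - t) * of_int d \<le> real_of_int (h - t) * of_int h"
      using that d by (intro mult_left_mono) auto
    then show "real_of_int d - real_of_int t * of_int d / of_int h \<le> of_int h - of_int t"
      using h by (simp add: field_simps)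
  qed
  have seg: "(of_int (fst p) + of_int (y - snd p) * of_int d / of_int h, of_int y) \<in> P"
    if "snd p \<le> y" "y \<le> snd q" for y
    using slanted_mem_convex[OF cvx mem(1,2) pq(1) h that] by (simp add: d_def)
  have r': "emb (snd r - M, snd r) \<in> P"
    unfolding emb_def fst_conv snd_conv
  proof (rule horizontal_mem_convex[OF cvx mem(3)[unfolded emb_def] seg[OF rs(1,2)]])
    show "real_of_int (fst r) \<le> of_int (snd r - M)" using NM by linarith
    have "real_of_int (snd r - M) \<le> of_int (fst q - snd q + snd r)" using NM by linarith
    also have "\<dots> \<le> of_int (fst p) + of_int (snd r - snd p) * of_int d / of_int h"
      using frac(3)[of "snd r - snd p"] rs pq(1) by (simp add: d_def)
    finally show "real_of_int (snd r - M)
      \<le> of_int (fst p) + of_int (snd r - snd p) * of_int d / of_int h" .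
  qed
  have s': "emb (snd s - N, snd s) \<in> P"
    unfolding emb_def fst_conv snd_conv
  proof (rule horizontal_mem_convex[OF cvx seg[OF rs(3,4)] mem(4)[unfolded emb_def]])
    show "real_of_int (snd s - N) \<le> of_int (fst s)" using NM by linarith
    have "real_of_int (fst p) + of_int (snd s - snd p) * of_int d / of_int h
      \<le> of_int (fst p + (snd s - snd p))"
      using frac(2)[of "snd s - snd p"] rs pq(1) by simp
    also have "\<dots> \<le> of_int (snd s - N)" using NM by linarith
    finally show "real_of_int (fst p) + of_int (snd s - snd p) * of_int d / of_int h
      \<le> of_int (snd s - N)" .
  qed
  \<comment> \<open>In the new coordinates \<open>p\<close> is on the bottom side, \<open>q\<close>
    on the top, the moved \<open>s\<close> on the left and the moved \<open>r\<close> on the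
    right.\<close>
  obtain f where f: "aff_unimodular f" "minimal_of_size h (f ` P)"
    "\<And>x y. emb (x, y) \<in> P \<Longrightarrow> emb (-1 * x + 1 * y + - N, 0 * x + 1 * y + - snd p) \<in> f ` P"
    by (rule minimal_of_size_transform[OF P, of "-1" 1 1 0 "- N" "- snd p"]) auto
  have "in_list h (f ` P)"
  proof (rule in_list_of_touching_four_sides[OF f(2)])
    show "emb (snd p - fst p - N, 0) \<in> f ` P" using f(3)[of "fst p" "snd p"] mem(1) by simp
    show "emb (0, snd s - snd p) \<in> f ` P" using f(3)[OF s'] by simp
    show "emb (h, h - (h - (snd r - snd p))) \<in> f ` P" using f(3)[OF r'] by (simp add: M_def)
    show "emb (h - (h - (snd q - fst q - N)), h) \<in> f ` P"
      using f(3)[of "fst q" "snd q"] mem(2) pq(1) by (simp add: algebra_simps)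
  qed (use NM pq rs M_def in auto)
  then show ?thesis using in_list_of_image f(1) by blast
qed

lemma in_list_of_full_height:
  assumes P: "minimal_of_size h P" and S: "finite S" "S \<noteq> {}" "P = convex hull (emb ` S)"
    and sq: "S \<subseteq> {0..h} \<times> {0..h}" and pq: "(p, 0) \<in> S" "(q, h) \<in> S" "p \<le> q"
  shows "in_list h P"
proof -
  have h: "h \<ge> 1" using P by (simp add: minimal_of_size_def)
  have wide: "wide h S"
    using wide_of_ls_ge[OF S(1,2) _ h] P S(3) by (simp add: minimal_of_size_def)
  have mem: "emb z \<in> P" if "z \<in> S" for z unfolding S(3) using that by (simp add: hull_inc)
  have bd: "0 \<le> fst z \<and> fst z \<le> h \<and> 0 \<le> snd z \<and> snd z \<le> h" if "z \<in> S" for z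
    using subsetD[OF sq that] by (auto simp: mem_Times_iff)
  show ?thesis
  proof (cases "\<exists>z\<in>S. \<exists>w\<in>S. fst z - fst w \<ge> h")
    case True
    then obtain z w where zw: "z \<in> S" "w \<in> S" "fst z = h" "fst w = 0"
      using bd by (smt (verit))
    then have "z = (h, h - (h - snd z))" "w = (0, snd w)" by (auto simp: prod_eq_iff)
    then have "emb (h, h - (h - snd z)) \<in> P" "emb (0, snd w) \<in> P"
      using mem[OF zw(1)] mem[OF zw(2)] by simp_all
    moreover have "emb (p, 0) \<in> P" "emb (h - (h - q), h) \<in> P" using mem[OF pq(1)] mem[OF pq(2)] by simp_all
    ultimately show ?thesis
      using bd[OF zw(1)] bd[OF zw(2)] bd[OF pq(1)] bd[OF pq(2)]
      by (intro in_list_of_touching_four_sides[OF P, of p "snd w" "h - snd z" "h - q"]) auto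
  next
    case False
    define F where "F = (\<lambda>z :: int \<times> int. snd z - fst z)"
    obtain z w where zw: "z \<in> S" "w \<in> S" "h \<le> \<bar>F z - F w\<bar>"
    proof -
      from wide obtain z w where zw: "z \<in> S" "w \<in> S" "h \<le> \<bar>1 * (fst z - fst w) + 0 * (snd z - snd w)\<bar> \<or>
                     h \<le> \<bar>-1 * (fst z - fst w) + 1 * (snd z - snd w)\<bar>"
        using wideD[OF wide, of 1 1 0 "-1"] by auto
      then have "h \<le> \<bar>F z - F w\<bar>" using False unfolding F_def by (smt (verit))
      then show ?thesis using that zw by blast
    qed
    obtain r where r: "r \<in> S" "\<And>z. z \<in> S \<Longrightarrow> F z \<le> F r"
      using S(1,2) arg_min_if_finite(1)[of S "\<lambda>z. - F z"] arg_min_least[of S _ "\<lambda>z. - F z"]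
      by (metis neg_le_iff_le)
    obtain s where s: "s \<in> S" "\<And>z. z \<in> S \<Longrightarrow> F s \<le> F z"
      using S(1,2) by (metis arg_min_if_finite(1) arg_min_least)
    have "h \<le> F r - F s" using zw r(2)[OF zw(1)] r(2)[OF zw(2)] s(2)[OF zw(1)] s(2)[OF zw(2)] by linarith
    moreover have "q - p < h" using False pq by force
    ultimately show ?thesis
      using r(2)[OF pq(2)] s(2)[OF pq(1)] bd[OF r(1)] bd[OF s(1)] pq(3) unfolding F_def
      by (intro in_list_of_skew[OF P mem[OF pq(1)] mem[OF pq(2)] mem[OF r(1)] mem[OF s(1)]]) auto
  qed
qed

section \<open>Reduction to the square and conclusion\<close>

text \<open>Attainment of the infimum is not presupposed: some admissible \<open>l\<close> is below
  \<open>h + 1\<close>, and lattice points in \<open>[0, l]^2\<close> already have coordinates at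
  most \<open>h\<close>.\<close>

lemma minimal_of_size_in_square:
  assumes P: "minimal_of_size h P"
  obtains f S where "aff_unimodular f" "finite S" "S \<noteq> {}" "f ` P = convex hull (emb ` S)"
    "S \<subseteq> {0..h} \<times> {0..h}"
proof -
  have lp: "lattice_polygon P" using P by (simp add: minimal_of_size_def minimal_lp_def)
  have "Inf (ls_set P) < of_int (h + 1)"
    using P by (simp add: minimal_of_size_def ls_sq_eq_Inf)
  then obtain l where l: "l \<in> ls_set P" "l < of_int (h + 1)"
    using cInf_lessD[OF ls_set_nonempty[OF lp]] by blast
  then obtain f where f: "aff_unimodular f" "f ` P \<subseteq> {0..l} \<times> {0..l}" by (auto simp: ls_set_def)
  obtain S where S: "finite S" "S \<noteq> {}" "f ` P = convex hull (emb ` S)"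
    using aff_unimodular_lattice_polygon[OF f(1) lp] by (auto simp: lattice_polygon_iff_emb)
  have "z \<in> {0..h} \<times> {0..h}" if "z \<in> S" for z
  proof -
    have "emb z \<in> {0..l} \<times> {0..l}" using f(2) that unfolding S(3) by (meson hull_inc image_eqI subsetD)
    then have "0 \<le> real_of_int (fst z)" "real_of_int (fst z) < of_int (h + 1)"
      "0 \<le> real_of_int (snd z)" "real_of_int (snd z) < of_int (h + 1)"
      using l(2) by (auto simp: emb_def)
    then show ?thesis unfolding of_int_less_iff of_int_0_le_iff by (simp add: mem_Times_iff)
  qed
  then show ?thesis using that f(1) S by blast
qed

lemma in_list_of_transform_hull:
  fixes a b c d v w :: int
  assumes "minimal_of_size h (convex hull (emb ` S))" "a * d - b * c = 1 \<or> a * d - b * c = -1"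
    and "minimal_of_size h (convex hull (emb ` (\<lambda>(x, y). (a * x + b * y + v, c * x + d * y + w)) ` S))
      \<Longrightarrow> in_list h (convex hull (emb ` (\<lambda>(x, y). (a * x + b * y + v, c * x + d * y + w)) ` S))"
  shows "in_list h (convex hull (emb ` S))"
proof -
  obtain f where f: "aff_unimodular f"
    "\<And>x y. f (emb (x, y)) = emb (a * x + b * y + v, c * x + d * y + w)"
    by (rule minimal_of_size_transform[OF assms(1,2), of v w]) blast
  have "f ` emb ` S = emb ` (\<lambda>(x, y). (a * x + b * y + v, c * x + d * y + w)) ` S"
    using f(2) by (auto simp: image_image case_prod_beta' intro!: image_cong)
  then show ?thesis
    using in_list_of_image[OF f(1)] minimal_of_size_image[OF f(1) assms(1)] assms(3)
      aff_unimodular_convex_hull[OF f(1)] by metis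
qed

lemma in_list_of_snd_diff:
  assumes P: "minimal_of_size h (convex hull (emb ` S))" and S: "finite S" "S \<noteq> {}"
    and sq: "S \<subseteq> {0..h} \<times> {0..h}" and pq: "(p, 0) \<in> S" "(q, h) \<in> S"
  shows "in_list h (convex hull (emb ` S))"
proof (cases "p \<le> q")
  case True
  then show ?thesis using in_list_of_full_height[OF P S refl sq pq] by simp
next
  case False
  \<comment> \<open>Reflecting \<open>y\<close> to \<open>h - y\<close> exchanges bottom and top,
    which reverses the order of \<open>p\<close> and \<open>q\<close>.\<close>
  let ?f = "\<lambda>(x, y). (1 * x + 0 * y + 0, 0 * x + -1 * y + h)"
  show ?thesis
  proof (rule in_list_of_transform_hull[OF P])
    assume "minimal_of_size h (convex hull (emb ` ?f ` S))"
    then show "in_list h (convex hull (emb ` ?f ` S))"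
    proof (rule in_list_of_full_height[OF _ _ _ refl])
      show "?f ` S \<subseteq> {0..h} \<times> {0..h}" using sq by auto
      show "(q, 0) \<in> ?f ` S" using pq(2) by force
      show "(p, h) \<in> ?f ` S" using pq(1) by force
    qed (use S False in auto)
  qed simp
qed

lemma in_list_of_minimal:
  assumes P: "minimal_of_size h P"
  shows "in_list h P"
proof -
  obtain f S where f: "aff_unimodular f" and S: "finite S" "S \<noteq> {}" "f ` P = convex hull (emb ` S)"
    "S \<subseteq> {0..h} \<times> {0..h}"
    using minimal_of_size_in_square[OF P] by blast
  have Q: "minimal_of_size h (convex hull (emb ` S))"
    using minimal_of_size_image[OF f P] S(3) by simp
  then have "wide h S"
    using wide_of_ls_ge[OF S(1,2)] by (simp add: minimal_of_size_def)
  \<comment> \<open>Testing wideness on the standard basis gives a coordinate difference of at least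
    \<open>h\<close>, which inside the square must run from 0 to \<open>h\<close>.\<close>
  then obtain z w where zw: "z \<in> S" "w \<in> S" "h \<le> \<bar>1 * (fst z - fst w) + 0 * (snd z - snd w)\<bar> \<or>
                     h \<le> \<bar>0 * (fst z - fst w) + 1 * (snd z - snd w)\<bar>"
    using wideD[OF _, of h S 1 1 0 0] by auto
  have bd: "0 \<le> fst z \<and> fst z \<le> h \<and> 0 \<le> snd z \<and> snd z \<le> h" if "z \<in> S" for z
    using subsetD[OF S(4) that] by (auto simp: mem_Times_iff)
  consider p q where "(p, 0) \<in> S" "(q, h) \<in> S" | p q where "(0, p) \<in> S" "(h, q) \<in> S"
  proof -
    have "snd z = 0 \<and> snd w = h \<or> snd w = 0 \<and> snd z = h \<or> fst z = 0 \<and> fst w = h \<or> fst w = 0 \<and> fst z = h"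
      using zw(3) bd[OF zw(1)] bd[OF zw(2)] by (smt (verit) mult_1 mult_zero_left)
    then show ?thesis using that zw(1,2) by (metis prod.collapse)
  qed
  then have "in_list h (convex hull (emb ` S))"
  proof cases
    case 1
    then show ?thesis using in_list_of_snd_diff[OF Q S(1,2,4)] by blast
  next
    case 2
    \<comment> \<open>Exchanging the coordinates reduces full width to full height.\<close>
    let ?f = "\<lambda>(x, y). (0 * x + 1 * y + 0, 1 * x + 0 * y + 0)"
    show ?thesis
    proof (rule in_list_of_transform_hull[OF Q])
      assume "minimal_of_size h (convex hull (emb ` ?f ` S))"
      then show "in_list h (convex hull (emb ` ?f ` S))"
      proof (rule in_list_of_snd_diff)
        show "?f ` S \<subseteq> {0..h} \<times> {0..h}" using S(4) by auto
        show "(p, 0) \<in> ?f ` S" using 2 by force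
        show "(q, h) \<in> ?f ` S" using 2 by force
      qed (use S in auto)
    qed simp
  qed
  then have "in_list h (f ` P)" unfolding S(3) .
  then show ?thesis by (rule in_list_of_image[OF f])
qed

theorem mainTheorem8:
  fixes h :: int and P :: "pt set"
  assumes "h \<ge> 1"
    and "lattice_polygon P"
    and "ls_sq P = of_int h"
    and "minimal_lp P"
  shows "lattice_equiv P (convex hull {(0, 0), (of_int h, 0)})
    \<or> (\<exists>a b :: int. 1 \<le> a \<and> a \<le> h - 1 \<and> 1 \<le> b \<and> b \<le> h - 1 \<and> a + b \<ge> h \<and>
         lattice_equiv P (convex hull {(0, 0), (of_int a, of_int h), (of_int h, of_int b)}))
    \<or> (\<exists>a b c d :: int. 1 \<le> a \<and> a \<le> h - 1 \<and> 1 \<le> b \<and> b \<le> h - 1 \<and>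
         1 \<le> c \<and> c \<le> h - 1 \<and> 1 \<le> d \<and> d \<le> h - 1 \<and> min a b + min c d > h \<and>
         lattice_equiv P (convex hull {(of_int a, 0), (0, of_int b),
                                       (of_int h, of_int (h - c)), (of_int (h - d), of_int h)}))"
proof -
  have "in_list h P"
    by (rule in_list_of_minimal) (use assms in \<open>simp add: minimal_of_size_def\<close>)
  then show ?thesis unfolding in_list_def .
qed

end
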